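(* There is no function $f$ for which the inequality $b_H(\Gamma)\le n^{f(r)}$ holds for all $r$, all (finite) abelian groups $H$ of rank at most $r$, and all permutation groups $\Gamma$ of degree $n$, where $n=|H|$.
   Context: A permutation group on a set is regular if it is transitive and all its point stabilizers are trivial. For a group $H$ and a permutation group $\Gamma$, $\mathrm{Reg}(\Gamma,H)$ denotes the set of all regular subgroups of $\Gamma$ that are isomorphic to $H$. The group $\Gamma$ acts on $\mathrm{Reg}(\Gamma,H)$ by conjugation, and $b_H(\Gamma)$ denotes the number of orbits of this action. The rank of a finite abelian group is its minimal number of generators. The function $f$ is a real-valued function of the positive integer $r$. *)

theory Defs
  imports Complex_Main "HOL-Algebra.Group_Action" "HOL-Algebra.Generated_Groups"
begin

text \<open>
  A permutation group on \<open>\<Omega>\<close> is given by its set of elements, a subgroup of \<open>BijGroup \<Omega>\<close>, the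
  symmetric group on \<open>\<Omega>\<close>; its degree is \<open>card \<Omega>\<close>.  Finite groups and finite permutation domains
  are taken over the type \<^typ>\<open>nat\<close> when quantified over inside a formula; up to isomorphism this
  covers all of them.
\<close>

definition perm_group :: "'a set \<Rightarrow> ('a \<Rightarrow> 'a) set \<Rightarrow> ('a \<Rightarrow> 'a) monoid"
  where "perm_group \<Omega> \<Gamma> = (BijGroup \<Omega>)\<lparr>carrier := \<Gamma>\<rparr>"

definition regular_perm_group :: "'a set \<Rightarrow> ('a \<Rightarrow> 'a) set \<Rightarrow> bool"
  where "regular_perm_group \<Omega> \<Gamma> \<longleftrightarrow>
    transitive_action (perm_group \<Omega> \<Gamma>) \<Omega> (\<lambda>g. g) \<and>
    (\<forall>x\<in>\<Omega>. stabilizer (perm_group \<Omega> \<Gamma>) (\<lambda>g. g) x = {\<one>\<^bsub>perm_group \<Omega> \<Gamma>\<^esub>})"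

definition Reg :: "'a set \<Rightarrow> ('a \<Rightarrow> 'a) set \<Rightarrow> ('b, 'c) monoid_scheme \<Rightarrow> ('a \<Rightarrow> 'a) set set"
  where "Reg \<Omega> \<Gamma> H =
    {K. subgroup K (perm_group \<Omega> \<Gamma>) \<and> regular_perm_group \<Omega> K \<and> perm_group \<Omega> K \<cong> H}"

definition conj_on :: "('a, 'c) monoid_scheme \<Rightarrow> 'a set set \<Rightarrow> 'a \<Rightarrow> 'a set \<Rightarrow> 'a set"
  where "conj_on G E = (\<lambda>g. \<lambda>K\<in>E. g <#\<^bsub>G\<^esub> K #>\<^bsub>G\<^esub> inv\<^bsub>G\<^esub> g)"

definition b_num :: "('b, 'c) monoid_scheme \<Rightarrow> 'a set \<Rightarrow> ('a \<Rightarrow> 'a) set \<Rightarrow> nat"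
  where "b_num H \<Omega> \<Gamma> =
    card (orbits (perm_group \<Omega> \<Gamma>) (Reg \<Omega> \<Gamma> H) (conj_on (perm_group \<Omega> \<Gamma>) (Reg \<Omega> \<Gamma> H)))"

definition group_rank :: "('b, 'c) monoid_scheme \<Rightarrow> nat"
  where "group_rank G =
    (LEAST k. \<exists>A. A \<subseteq> carrier G \<and> finite A \<and> card A = k \<and> generate G A = carrier G)"

end

theory Submission
  imports Defs "HOL-Library.Nat_Bijection"
begin

text \<open>
  Already rank \<open>2\<close> defeats every polynomial bound.  Let \<open>H\<close> be the square of the cyclic group of
  order \<open>m = 2\<^sup>a\<close>, acting on itself by translations, and let \<open>z\<close> be an involution of \<open>H\<close>.  A
  \<open>z\<close>-invariant function \<open>F\<close> from \<open>H\<close> to the field with two elements (below: the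
  subset of \<open>H\<close> on which \<open>F = 1\<close>) gives the permutation \<open>u \<mapsto> z\<^sup>F\<^sup>(\<^sup>u\<^sup>) u\<close>, and conjugating
  the translations by it gives a regular group \<open>K\<^sub>F\<close> isomorphic to \<open>H\<close>.  The elements of
  \<open>K\<^sub>F\<close> are translations twisted by the differences \<open>F(h u) - F(u)\<close>.

  Call \<open>F\<close> of level \<open>0\<close> if all its differences are constant, and of level \<open>k + 1\<close> if all its
  differences are of level \<open>k\<close>; so levels are polynomial degrees, up to a shift.  The
  translations and the twists by functions of level \<open>k\<close> generate a group \<open>\<Gamma>\<^sub>k\<close>.  It
  contains \<open>K\<^sub>F\<close> whenever \<open>F\<close> has level \<open>k + 1\<close>, but it conjugates \<open>K\<^sub>F\<close> to \<open>K\<^sub>G\<close> only if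
  \<open>F - G\<close> has level \<open>k\<close> (\<open>sym_diff_in_poly_sets_of_conj\<close>).  Hence, if \<open>p\<^sub>k\<close> is the number of
  functions of level \<open>k\<close>, then \<open>p\<^sub>k\<^sub>+\<^sub>1 \<le> b p\<^sub>k\<close> for the number \<open>b\<close> of conjugacy classes of
  such regular subgroups of \<open>\<Gamma>\<^sub>k\<close> (\<open>b_num_bound\<close>).

  The difference operators of the two generators have vanishing \<open>m\<close>-th power, because
  \<open>(X - 1)\<^sup>m = X\<^sup>m - 1\<close> in characteristic \<open>2\<close>.  So every invariant function has level \<open>2 m\<close>
  (\<open>diff_funpow_in_poly_sets\<close>).  There are at least \<open>2\<close> to the power \<open>m\<^sup>2 / 2\<close> such functions
  and at most \<open>8\<close> of level \<open>0\<close>.  If all the groups \<open>\<Gamma>\<^sub>k\<close> had at most \<open>N\<close> classes, then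
  \<open>2\<close> to the power \<open>m\<^sup>2\<close> would be at most \<open>(8 N\<^sup>2\<^sup>m)\<^sup>2\<close> (\<open>b_num_lower_bound\<close>); but for \<open>N\<close>
  a fixed power of the degree \<open>m\<^sup>2\<close>, the logarithm of the right-hand side only grows like
  \<open>m log m\<close>.
\<close>

section \<open>Counting along fibres\<close>

text \<open>
  The fibre bound behind a homomorphism of elementary abelian \<open>2\<close>-groups, the group operation
  being symmetric difference: translating a fibre by one of its points embeds it in \<open>C\<close>.
\<close>
lemma card_le_fibres_sym_diff:
  assumes "finite B" "finite C" "f ` A \<subseteq> B"
    and diff: "\<And>S S'. S \<in> A \<Longrightarrow> S' \<in> A \<Longrightarrow> f S = f S' \<Longrightarrow> sym_diff S S' \<in> C"
  shows "card A \<le> card B * card C"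
proof -
  have fibre: "card {S \<in> A. f S = y} \<le> card C" for y
  proof (cases "{S \<in> A. f S = y} = {}")
    case False
    then obtain S0 where S0: "S0 \<in> A" "f S0 = y" by blast
    show "card {S \<in> A. f S = y} \<le> card C"
    proof (rule card_inj_on_le)
      show "inj_on (sym_diff S0) {S \<in> A. f S = y}" by (rule inj_onI) blast
      show "sym_diff S0 ` {S \<in> A. f S = y} \<subseteq> C" using diff S0 by blast
    qed fact
  qed (metis card.empty le0)
  have "A = (\<Union>y\<in>B. {S \<in> A. f S = y})" using \<open>f ` A \<subseteq> B\<close> by blast
  then have "card A \<le> (\<Sum>y\<in>B. card {S \<in> A. f S = y})"
    using card_UN_le[OF \<open>finite B\<close>, of "\<lambda>y. {S \<in> A. f S = y}"] by simp
  also have "\<dots> \<le> card B * card C" using sum_bounded_above[of B _ "card C"] fibre by simp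
  finally show ?thesis .
qed

section \<open>Invariant sets, differences and levels\<close>

locale involution_group = comm_group H for H (structure) +
  fixes z
  assumes finite_carrier: "finite (carrier H)"
    and z_closed [simp]: "z \<in> carrier H"
    and z_sq: "z \<otimes> z = \<one>"
    and z_neq: "z \<noteq> \<one>"
begin

definition inv_sets :: "'a set set"
  where "inv_sets = {S. S \<subseteq> carrier H \<and> (\<forall>u\<in>carrier H. z \<otimes> u \<in> S \<longleftrightarrow> u \<in> S)}"

definition shift :: "'a \<Rightarrow> 'a set \<Rightarrow> 'a set"
  where "shift h S = {u \<in> carrier H. h \<otimes> u \<in> S}"

text \<open>
  In terms of indicator functions with values modulo \<open>2\<close>, this is \<open>F(h u) - F(u)\<close>.
\<close>
definition diff :: "'a \<Rightarrow> 'a set \<Rightarrow> 'a set"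
  where "diff h S = {u \<in> carrier H. (h \<otimes> u \<in> S) \<noteq> (u \<in> S)}"

text \<open>
  The level filtration by polynomial degree.  Starting with the affine functions rather than with
  the constants matters: \<open>F\<close> and \<open>G\<close> give the same regular group exactly if \<open>F - G\<close> is
  affine, so that each level already contains this ambiguity.
\<close>
primrec poly_sets :: "nat \<Rightarrow> 'a set set"
  where
    "poly_sets 0 = {S \<in> inv_sets. \<forall>h\<in>carrier H. diff h S \<in> {{}, carrier H}}"
  | "poly_sets (Suc k) = {S \<in> inv_sets. \<forall>h\<in>carrier H. diff h S \<in> poly_sets k}"

text \<open>
  Multiplication by the function with values in \<open>{\<one>, z}\<close> which is \<open>z\<close> exactly on \<open>S\<close>.
\<close>
definition twist :: "'a set \<Rightarrow> 'a \<Rightarrow> 'a"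
  where "twist S u = (if u \<in> S then z \<otimes> u else u)"

definition twisted_translation :: "'a \<Rightarrow> 'a set \<Rightarrow> 'a \<Rightarrow> 'a"
  where "twisted_translation t T = (\<lambda>u\<in>carrier H. t \<otimes> twist T u)"

definition ambient :: "nat \<Rightarrow> ('a \<Rightarrow> 'a) set"
  where "ambient k = {twisted_translation t T |t T. t \<in> carrier H \<and> T \<in> poly_sets k}"

text \<open>
  The conjugate of the regular representation of \<open>H\<close> by \<open>twist S\<close>; see
  \<open>twisted_translation_conj\<close>.  This form shows which groups \<open>ambient k\<close> contain it.
\<close>
definition twisted_copy :: "'a set \<Rightarrow> ('a \<Rightarrow> 'a) set"
  where "twisted_copy S = (\<lambda>h. twisted_translation h (diff h S)) ` carrier H"

lemma zz_cancel [simp]: "u \<in> carrier H \<Longrightarrow> z \<otimes> (z \<otimes> u) = u"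
  using m_assoc[of z z u] z_sq by simp

text \<open>
  For moving \<open>z\<close> to the front by rewriting; the side condition prevents a loop at \<open>h = z\<close>.
\<close>
lemma z_left: "NO_MATCH z h \<Longrightarrow> h \<in> carrier H \<Longrightarrow> u \<in> carrier H \<Longrightarrow> h \<otimes> (z \<otimes> u) = z \<otimes> (h \<otimes> u)"
  by (simp add: m_lcomm)

lemma z_mult_neq [simp]: "u \<in> carrier H \<Longrightarrow> z \<otimes> u \<noteq> u"
  using z_neq by (metis r_cancel_one z_closed)

lemma inv_setsD: "S \<in> inv_sets \<Longrightarrow> S \<subseteq> carrier H"
  "S \<in> inv_sets \<Longrightarrow> u \<in> carrier H \<Longrightarrow> z \<otimes> u \<in> S \<longleftrightarrow> u \<in> S"
  by (auto simp: inv_sets_def)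

lemma inv_sets_left: "S \<in> inv_sets \<Longrightarrow> h \<in> carrier H \<Longrightarrow> u \<in> carrier H \<Longrightarrow> h \<otimes> (z \<otimes> u) \<in> S \<longleftrightarrow> h \<otimes> u \<in> S"
  by (metis inv_setsD(2) m_closed m_lcomm z_closed)

lemma finite_inv_sets: "finite inv_sets"
  by (rule finite_subset[of _ "Pow (carrier H)"]) (auto simp: inv_sets_def finite_carrier)

lemma inv_sets_sym_diff: "S \<in> inv_sets \<Longrightarrow> T \<in> inv_sets \<Longrightarrow> sym_diff S T \<in> inv_sets"
  by (auto simp: inv_sets_def)

lemma inv_sets_shift: "S \<in> inv_sets \<Longrightarrow> h \<in> carrier H \<Longrightarrow> shift h S \<in> inv_sets"
  using inv_sets_left unfolding inv_sets_def shift_def by auto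

lemma diff_eq: "h \<in> carrier H \<Longrightarrow> S \<in> inv_sets \<Longrightarrow> diff h S = sym_diff (shift h S) S"
  using inv_setsD(1) by (auto simp: diff_def shift_def)

lemma inv_sets_diff: "S \<in> inv_sets \<Longrightarrow> h \<in> carrier H \<Longrightarrow> diff h S \<in> inv_sets"
  by (simp add: diff_eq inv_sets_sym_diff inv_sets_shift)

lemma diff_sym_diff: "h \<in> carrier H \<Longrightarrow> diff h (sym_diff S T) = sym_diff (diff h S) (diff h T)"
  by (auto simp: diff_def)

lemma diff_shift: "g \<in> carrier H \<Longrightarrow> h \<in> carrier H \<Longrightarrow> diff g (shift h S) = shift h (diff g S)"
  by (auto simp: diff_def shift_def m_lcomm)

text \<open>
  The cocycle identity, which makes \<open>h \<mapsto> twisted_translation h (diff h S)\<close> a homomorphism and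
  reduces difference operators to those of generators.
\<close>
lemma diff_mult: "g \<in> carrier H \<Longrightarrow> h \<in> carrier H \<Longrightarrow> diff (g \<otimes> h) S = sym_diff (shift h (diff g S)) (diff h S)"
  by (auto simp: diff_def shift_def m_assoc)

lemma diff_one: "diff \<one> S = {}"
  by (auto simp: diff_def)

lemma poly_sets_inv_sets: "poly_sets k \<subseteq> inv_sets"
  by (cases k) auto

lemma finite_poly_sets: "finite (poly_sets k)"
  using finite_subset[OF poly_sets_inv_sets finite_inv_sets] .

lemma poly_sets_0_const: "{} \<in> poly_sets 0" "carrier H \<in> poly_sets 0"
  by (auto simp: inv_sets_def diff_def)

lemma poly_sets_diff: "S \<in> poly_sets (Suc k) \<Longrightarrow> h \<in> carrier H \<Longrightarrow> diff h S \<in> poly_sets k"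
  by simp

lemma poly_sets_SucI: "S \<in> inv_sets \<Longrightarrow> (\<And>h. h \<in> carrier H \<Longrightarrow> diff h S \<in> poly_sets k) \<Longrightarrow> S \<in> poly_sets (Suc k)"
  by simp

lemma poly_sets_mono_Suc: "S \<in> poly_sets k \<Longrightarrow> S \<in> poly_sets (Suc k)"
proof (induction k arbitrary: S)
  case 0
  have "diff h S \<in> poly_sets 0" if "h \<in> carrier H" for h
  proof -
    have "diff h S = {} \<or> diff h S = carrier H" using 0 that by simp
    then show ?thesis using poly_sets_0_const by metis
  qed
  then show ?case using 0 poly_sets_inv_sets by (blast intro: poly_sets_SucI)
next
  case (Suc k)
  then show ?case using poly_sets_inv_sets poly_sets_diff by (blast intro: poly_sets_SucI)
qed

lemma poly_sets_0_subset: "poly_sets 0 \<subseteq> poly_sets k"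
  by (induction k) (use poly_sets_mono_Suc in blast)+

lemma poly_sets_sym_diff: "S \<in> poly_sets k \<Longrightarrow> T \<in> poly_sets k \<Longrightarrow> sym_diff S T \<in> poly_sets k"
proof (induction k arbitrary: S T)
  case 0
  then have "diff h (sym_diff S T) \<in> {{}, carrier H}" if "h \<in> carrier H" for h
    using that unfolding poly_sets.simps diff_sym_diff[OF that] by auto
  with 0 show ?case by (simp add: inv_sets_sym_diff)
qed (simp add: inv_sets_sym_diff diff_sym_diff)

lemma poly_sets_shift: "S \<in> poly_sets k \<Longrightarrow> h \<in> carrier H \<Longrightarrow> shift h S \<in> poly_sets k"
proof (induction k arbitrary: S)
  case 0
  have "shift h {} = {}" "shift h (carrier H) = carrier H" using \<open>h \<in> carrier H\<close> by (auto simp: shift_def)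
  with 0 show ?case by (auto simp: inv_sets_shift diff_shift)
qed (simp add: inv_sets_shift diff_shift)

lemma empty_in_poly_sets: "{} \<in> poly_sets k"
  using poly_sets_0_const poly_sets_0_subset by blast

lemma twist_closed [simp]: "u \<in> carrier H \<Longrightarrow> twist S u \<in> carrier H"
  by (simp add: twist_def)

lemma twisted_translation_apply: "u \<in> carrier H \<Longrightarrow> twisted_translation t T u = t \<otimes> twist T u"
  by (simp add: twisted_translation_def)

section \<open>The regular subgroups and the groups containing them\<close>

lemma compose_twisted_translation:
  assumes "t \<in> carrier H" "s \<in> carrier H" "T \<in> inv_sets" "R \<in> inv_sets"
  shows "compose (carrier H) (twisted_translation t T) (twisted_translation s R) = twisted_translation (t \<otimes> s) (sym_diff (shift s T) R)"
  using assms inv_setsD(1)[of R]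
  by (auto simp: compose_def twisted_translation_def twist_def shift_def z_left m_assoc inv_setsD(2) intro!: restrict_ext)

lemma twisted_translation_one: "twisted_translation \<one> {} = (\<lambda>u\<in>carrier H. u)"
  by (auto simp: twisted_translation_def twist_def)

lemma twisted_translation_in_Bij:
  assumes "t \<in> carrier H" "T \<in> inv_sets"
  shows "twisted_translation t T \<in> Bij (carrier H)"
proof -
  have inj: "inj_on (twisted_translation t T) (carrier H)"
  proof (rule inj_onI)
    fix u v assume uv: "u \<in> carrier H" "v \<in> carrier H" "twisted_translation t T u = twisted_translation t T v"
    then have "twist T u = twist T v" using assms by (simp add: twisted_translation_apply)
    then show "u = v" using uv assms inv_setsD(2)[OF assms(2)]
      by (auto simp: twist_def split: if_splits)
  qed
  moreover have "twisted_translation t T ` carrier H \<subseteq> carrier H" using assms by (auto simp: twisted_translation_apply)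
  ultimately have "bij_betw (twisted_translation t T) (carrier H) (carrier H)"
    by (simp add: bij_betw_def endo_inj_surj finite_carrier)
  then show ?thesis by (simp add: Bij_def twisted_translation_def)
qed

lemma mult_twisted_translation:
  assumes "t \<in> carrier H" "s \<in> carrier H" "T \<in> inv_sets" "R \<in> inv_sets"
  shows "twisted_translation t T \<otimes>\<^bsub>BijGroup (carrier H)\<^esub> twisted_translation s R = twisted_translation (t \<otimes> s) (sym_diff (shift s T) R)"
  using assms by (simp add: BijGroup_def twisted_translation_in_Bij compose_twisted_translation)

lemma finite_Bij: "finite (carrier (BijGroup (carrier H)))"
proof (rule finite_subset)
  show "carrier (BijGroup (carrier H)) \<subseteq> carrier H \<rightarrow>\<^sub>E carrier H"
    by (auto simp: BijGroup_def PiE_def dest: Bij_imp_funcset Bij_imp_extensional)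
  show "finite (carrier H \<rightarrow>\<^sub>E carrier H)" by (simp add: finite_PiE finite_carrier)
qed

lemma inv_twisted_translation:
  assumes "t \<in> carrier H" "T \<in> inv_sets"
  shows "inv\<^bsub>BijGroup (carrier H)\<^esub> (twisted_translation t T) = twisted_translation (inv t) (shift (inv t) T)"
proof (rule group.inv_equality[OF group_BijGroup])
  have "shift t (shift (inv t) T) = T"
    using assms inv_setsD(1)[of T] by (auto simp: shift_def m_assoc[symmetric])
  then show "twisted_translation (inv t) (shift (inv t) T) \<otimes>\<^bsub>BijGroup (carrier H)\<^esub> twisted_translation t T = \<one>\<^bsub>BijGroup (carrier H)\<^esub>"
    using assms by (simp add: mult_twisted_translation inv_sets_shift twisted_translation_one) (simp add: BijGroup_def)
qed (use assms in \<open>simp_all add: BijGroup_def twisted_translation_in_Bij inv_sets_shift\<close>)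

lemma subgroup_ambient: "subgroup (ambient k) (BijGroup (carrier H))"
proof (rule group.subgroupI[OF group_BijGroup])
  note inv = subsetD[OF poly_sets_inv_sets]
  show "ambient k \<subseteq> carrier (BijGroup (carrier H))"
    using twisted_translation_in_Bij inv by (auto simp: ambient_def BijGroup_def)
  show "ambient k \<noteq> {}" using empty_in_poly_sets by (auto simp: ambient_def)
  show "inv\<^bsub>BijGroup (carrier H)\<^esub> a \<in> ambient k" if "a \<in> ambient k" for a
    using that poly_sets_shift inv inv_closed inv_twisted_translation unfolding ambient_def by fastforce
  show "a \<otimes>\<^bsub>BijGroup (carrier H)\<^esub> b \<in> ambient k" if ab: "a \<in> ambient k" "b \<in> ambient k" for a b
  proof -
    from ab obtain t T s R where "a = twisted_translation t T" "b = twisted_translation s R"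
      and "t \<in> carrier H" "T \<in> poly_sets k" "s \<in> carrier H" "R \<in> poly_sets k" by (auto simp: ambient_def)
    then show ?thesis unfolding ambient_def
      using mult_twisted_translation[of t s T R] inv poly_sets_sym_diff[OF poly_sets_shift] by blast
  qed
qed

lemma twisted_copy_subset_ambient: "S \<in> poly_sets (Suc k) \<Longrightarrow> twisted_copy S \<subseteq> ambient k"
  by (auto simp: twisted_copy_def ambient_def)

lemma twisted_translation_conj:
  assumes "S \<in> inv_sets" "h \<in> carrier H" "u \<in> carrier H"
  shows "twisted_translation h (diff h S) u = twist S (h \<otimes> twist S u)"
  using assms by (auto simp: twisted_translation_def diff_def twist_def z_left inv_setsD(2))

lemma twist_twist: "S \<in> inv_sets \<Longrightarrow> u \<in> carrier H \<Longrightarrow> twist S (twist S u) = u"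
  by (auto simp: twist_def inv_setsD)

text \<open>
  Regularity and faithfulness in one: exactly one element of the twisted copy takes \<open>u\<close> to \<open>v\<close>.
\<close>
lemma twisted_translation_conj_eq_iff:
  assumes "S \<in> inv_sets" "h \<in> carrier H" "u \<in> carrier H" "v \<in> carrier H"
  shows "twisted_translation h (diff h S) u = v \<longleftrightarrow> h = twist S v \<otimes> inv (twist S u)"
proof -
  have "twisted_translation h (diff h S) u = v \<longleftrightarrow> h \<otimes> twist S u = twist S v"
    using assms twist_twist[of S v] twist_twist[of S "h \<otimes> twist S u"] by (auto simp: twisted_translation_conj)
  also have "\<dots> \<longleftrightarrow> h = twist S v \<otimes> inv (twist S u)"
    using assms by (auto simp: inv_solve_right)
  finally show ?thesis .
qed

lemma mult_twisted_copy:
  assumes "S \<in> inv_sets" "h \<in> carrier H" "g \<in> carrier H"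
  shows "twisted_translation h (diff h S) \<otimes>\<^bsub>BijGroup (carrier H)\<^esub> twisted_translation g (diff g S) = twisted_translation (h \<otimes> g) (diff (h \<otimes> g) S)"
  using assms by (simp add: mult_twisted_translation inv_sets_diff diff_mult)

lemma twisted_copy_hom: "S \<in> inv_sets \<Longrightarrow> (\<lambda>h. twisted_translation h (diff h S)) \<in> hom H (BijGroup (carrier H))"
  by (rule homI) (simp_all add: mult_twisted_copy BijGroup_def[of "carrier H"] twisted_translation_in_Bij inv_sets_diff flip: mult_twisted_copy)

lemma subgroup_twisted_copy: 
  assumes "S \<in> inv_sets"
  shows "subgroup (twisted_copy S) (BijGroup (carrier H))"
proof -
  interpret group_hom H "BijGroup (carrier H)" "\<lambda>h. twisted_translation h (diff h S)"
    by (intro group_hom.intro group_hom_axioms.intro twisted_copy_hom assms group_BijGroup is_group)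
  show ?thesis using img_is_subgroup unfolding twisted_copy_def .
qed

lemma inj_twisted_copy: 
  assumes "S \<in> inv_sets"
  shows "inj_on (\<lambda>h. twisted_translation h (diff h S)) (carrier H)"
proof (rule inj_onI)
  fix h g assume *: "h \<in> carrier H" "g \<in> carrier H" and eq: "twisted_translation h (diff h S) = twisted_translation g (diff g S)"
  have "twisted_translation g (diff g S) \<one> \<in> carrier H" using * by (simp add: twisted_translation_apply)
  then show "h = g" using eq twisted_translation_conj_eq_iff[OF assms *(1) one_closed]  twisted_translation_conj_eq_iff[OF assms *(2) one_closed]
    by metis
qed

lemma twisted_copy_iso: 
  assumes "S \<in> inv_sets"
  shows "perm_group (carrier H) (twisted_copy S) \<cong> H"
proof -
  have "(\<lambda>h. twisted_translation h (diff h S)) \<in> iso H (perm_group (carrier H) (twisted_copy S))"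
    using inj_twisted_copy[OF assms] twisted_copy_hom[OF assms] unfolding perm_group_def
    by (intro isoI) (auto simp: twisted_copy_def bij_betw_def hom_def)
  then show ?thesis using iso_sym is_isoI by blast
qed

lemma regular_twisted_copy:
  assumes S: "S \<in> inv_sets"
  shows "regular_perm_group (carrier H) (twisted_copy S)"
  unfolding regular_perm_group_def
proof (intro conjI ballI)
  interpret B: group "BijGroup (carrier H)" by (rule group_BijGroup)
  show "transitive_action (perm_group (carrier H) (twisted_copy S)) (carrier H) (\<lambda>g. g)"
  proof (intro transitive_action.intro group_action.intro transitive_action_axioms.intro)
    show "group_hom (perm_group (carrier H) (twisted_copy S)) (BijGroup (carrier H)) (\<lambda>g. g)"
      using B.canonical_inj_is_hom[OF subgroup_twisted_copy[OF S]] by (simp add: perm_group_def id_def)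
    fix u v assume "u \<in> carrier H" "v \<in> carrier H"
    then show "\<exists>g\<in>carrier (perm_group (carrier H) (twisted_copy S)). g u = v"
      using twisted_translation_conj_eq_iff[OF S] by (auto simp: perm_group_def twisted_copy_def)
  qed
  fix u assume u: "u \<in> carrier H"
  have "stabilizer (perm_group (carrier H) (twisted_copy S)) (\<lambda>g. g) u = {twisted_translation \<one> (diff \<one> S)}"
    using twisted_translation_conj_eq_iff[OF S _ u u] u r_inv[of "twist S u"]
    by (auto simp: stabilizer_def perm_group_def twisted_copy_def)
  then show "stabilizer (perm_group (carrier H) (twisted_copy S)) (\<lambda>g. g) u = {\<one>\<^bsub>perm_group (carrier H) (twisted_copy S)\<^esub>}"
    by (simp add: diff_one twisted_translation_one perm_group_def) (simp add: BijGroup_def)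
qed

lemma twisted_copy_in_Reg:
  assumes "S \<in> poly_sets (Suc k)"
  shows "twisted_copy S \<in> Reg (carrier H) (ambient k) H"
proof -
  have S: "S \<in> inv_sets" using assms poly_sets_inv_sets by blast
  have "subgroup (twisted_copy S) (perm_group (carrier H) (ambient k))"
    unfolding perm_group_def using group.subgroup_incl[OF group_BijGroup subgroup_twisted_copy[OF S] subgroup_ambient twisted_copy_subset_ambient[OF assms]] .
  then show ?thesis using S by (simp add: Reg_def regular_twisted_copy twisted_copy_iso)
qed

section \<open>Conjugacy and the level filtration\<close>

text \<open>
  The pair \<open>(t, T)\<close> is determined by its twisted translation only up to moving a factor \<open>z\<close>
  between \<open>t\<close> and the twist, which complements \<open>T\<close>.  This is where constant functions
  come in.
\<close>
lemma twisted_translation_eqD: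
  assumes s: "s \<in> carrier H" and r: "r \<in> carrier H" and A: "A \<subseteq> carrier H" and B: "B \<subseteq> carrier H"
    and eq: "twisted_translation s A = twisted_translation r B"
  shows "s = r \<or> s = z \<otimes> r" "sym_diff A B \<in> {{}, carrier H}"
proof -
  have u: "s \<otimes> twist A u = r \<otimes> twist B u" if "u \<in> carrier H" for u
    using fun_cong[OF eq, of u] that by (simp add: twisted_translation_apply)
  have same: "s = r" if "u \<in> carrier H" "u \<in> A \<longleftrightarrow> u \<in> B" for u
    using u[OF that(1)] that s r by (auto simp: twist_def split: if_splits)
  have opp: "s = z \<otimes> r" if "u \<in> carrier H" "u \<in> A \<longleftrightarrow> u \<notin> B" for u
  proof -
    have "s \<otimes> u = (z \<otimes> r) \<otimes> u"
    proof (cases "u \<in> A")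
      case True
      then have "z \<otimes> (s \<otimes> u) = r \<otimes> u" using u[OF that(1)] that s r by (simp add: twist_def m_lcomm)
      then show ?thesis using that s r by (metis m_assoc m_closed z_closed zz_cancel)
    next
      case False
      then show ?thesis using u[OF that(1)] that s r by (simp add: twist_def m_ac)
    qed
    then show ?thesis using that s r by simp
  qed
  show "s = r \<or> s = z \<otimes> r" using same[of \<one>] opp[of \<one>] by auto
  show "sym_diff A B \<in> {{}, carrier H}"
  proof (cases "s = r")
    case True
    then have "u \<in> A \<longleftrightarrow> u \<in> B" if "u \<in> carrier H" for u
      using opp[OF that] z_mult_neq[OF r] by metis
    then show ?thesis using A B by blast
  next
    case False
    then have "u \<in> A \<longleftrightarrow> u \<notin> B" if "u \<in> carrier H" for u using same[OF that] by metis
    then show ?thesis using A B by blast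
  qed
qed

text \<open>
  Conjugation by the translation by \<open>t\<close> twisted by \<open>T\<close> adds \<open>T\<close> to the function \<open>S\<close> and then
  translates the sum by \<open>t\<close>.  So \<open>U = S + T + shift t S'\<close> has constant differences, that is, level \<open>0\<close>, and
  \<open>S + S' = U + T + diff t S'\<close> is a sum of functions of level at most \<open>k\<close>.  The hypothesis is the
  equation \<open>g \<kappa> = \<kappa>' g\<close> for conjugate elements \<open>\<kappa>\<close> and \<open>\<kappa>'\<close>, free of inverses.
\<close>
lemma sym_diff_in_poly_sets_of_conj:
  assumes S: "S \<in> poly_sets (Suc k)" and S': "S' \<in> poly_sets (Suc k)" and t: "t \<in> carrier H" and T: "T \<in> poly_sets k"
    and conj: "\<And>h. h \<in> carrier H \<Longrightarrow> \<exists>h'\<in>carrier H. compose (carrier H) (twisted_translation t T) (twisted_translation h (diff h S))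
        = compose (carrier H) (twisted_translation h' (diff h' S')) (twisted_translation t T)"
  shows "sym_diff S S' \<in> poly_sets k"
proof -
  define U where "U = sym_diff (sym_diff S T) (shift t S')"
  have SI: "S \<in> inv_sets" and S'I: "S' \<in> inv_sets" and TI: "T \<in> inv_sets"
    using S S' T poly_sets_inv_sets by blast+
  have "diff h U \<in> {{}, carrier H}" if h: "h \<in> carrier H" for h
  proof -
    obtain h' where h': "h' \<in> carrier H" and eq: "compose (carrier H) (twisted_translation t T) (twisted_translation h (diff h S))
        = compose (carrier H) (twisted_translation h' (diff h' S')) (twisted_translation t T)" using conj[OF h] by blast
    have eq2: "twisted_translation (t \<otimes> h) (sym_diff (shift h T) (diff h S)) = twisted_translation (h' \<otimes> t) (sym_diff (shift t (diff h' S')) T)"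
      using eq by (simp add: compose_twisted_translation inv_sets_diff h h' t SI S'I TI)
    \<comment> \<open>Hence \<open>h'\<close> is \<open>h\<close> up to a factor \<open>z\<close>, which the differences of the invariant set \<open>S'\<close> do not see.\<close>
    have cases: "t \<otimes> h = h' \<otimes> t \<or> t \<otimes> h = z \<otimes> (h' \<otimes> t)"
      and diff: "sym_diff (sym_diff (shift h T) (diff h S)) (sym_diff (shift t (diff h' S')) T) \<in> {{}, carrier H}"
    proof -
      have "sym_diff (shift h T) (diff h S) \<subseteq> carrier H" "sym_diff (shift t (diff h' S')) T \<subseteq> carrier H"
        using inv_setsD(1)[OF TI] by (auto simp: shift_def diff_def)
      note * = twisted_translation_eqD[OF _ _ this eq2]
      show "t \<otimes> h = h' \<otimes> t \<or> t \<otimes> h = z \<otimes> (h' \<otimes> t)" using *(1) h h' t by simp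
      show "sym_diff (sym_diff (shift h T) (diff h S)) (sym_diff (shift t (diff h' S')) T) \<in> {{}, carrier H}"
        using *(2) h h' t by simp
    qed
    have "h \<otimes> t = h' \<otimes> t \<or> h \<otimes> t = (z \<otimes> h') \<otimes> t"
      using cases t h h' by (simp add: m_comm[of t h] m_assoc)
    then have "h = h' \<or> h = z \<otimes> h'"
      using t h h' by (simp only: right_cancel m_closed z_closed)
    then have "diff h' S' = diff h S'"
      using h' inv_setsD(2)[OF S'I] by (auto simp: diff_def m_assoc)
    then have "sym_diff (sym_diff (shift h T) (diff h S)) (sym_diff (shift t (diff h' S')) T)
        = sym_diff (sym_diff (shift h T) (diff h S)) (sym_diff (diff h (shift t S')) T)"
      by (simp add: diff_shift h t)
    also have "\<dots> = diff h U"
      unfolding U_def diff_sym_diff[OF h] diff_eq[OF h TI] by blast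
    finally show ?thesis using diff by simp
  qed
  moreover have "U \<in> inv_sets"
    unfolding U_def by (intro inv_sets_sym_diff inv_sets_shift SI TI S'I t)
  ultimately have "U \<in> poly_sets 0" by simp
  then have U: "U \<in> poly_sets k" using poly_sets_0_subset by blast
  have "diff t S' \<in> poly_sets k" using poly_sets_diff[OF S' t] .
  then have *: "sym_diff (sym_diff U T) (diff t S') \<in> poly_sets k" using U T poly_sets_sym_diff by blast
  have "diff t S' = sym_diff (shift t S') S'" using diff_eq[OF t S'I] by blast
  then have "sym_diff (sym_diff U T) (diff t S') = sym_diff S S'" unfolding U_def by blast
  then show ?thesis using * by simp
qed


lemma b_num_bound: "card (poly_sets (Suc k)) \<le> b_num H (carrier H) (ambient k) * card (poly_sets k)"
proof -
  let ?B = "BijGroup (carrier H)"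
  let ?G = "perm_group (carrier H) (ambient k)"
  let ?R = "Reg (carrier H) (ambient k) H"
  let ?c = "conj_on ?G ?R"
  interpret B: group ?B by (rule group_BijGroup)
  interpret G: group ?G unfolding perm_group_def
    using B.subgroup_imp_group[OF subgroup_ambient] .
  have carrier: "carrier ?G = ambient k" "mult ?G = mult ?B" "one ?G = one ?B"
    by (simp_all add: perm_group_def)
  have Reg_sub: "?R \<subseteq> Pow (ambient k)" using subgroup.subset by (fastforce simp: Reg_def carrier)
  have "finite (ambient k)"
    using finite_subset[OF subgroup.subset[OF subgroup_ambient] finite_Bij] .
  then have "finite (orbits ?G ?R ?c)"
    using finite_subset[OF Reg_sub] by (simp add: orbits_def)
  moreover have "(\<lambda>S. orbit ?G ?c (twisted_copy S)) ` poly_sets (Suc k) \<subseteq> orbits ?G ?R ?c"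
    using twisted_copy_in_Reg unfolding orbits_def by blast
  moreover have "sym_diff S S' \<in> poly_sets k"
    if S: "S \<in> poly_sets (Suc k)" and S': "S' \<in> poly_sets (Suc k)" and eq: "orbit ?G ?c (twisted_copy S) = orbit ?G ?c (twisted_copy S')" for S S'
  proof -
    have sub: "twisted_copy S \<subseteq> ambient k" "twisted_copy S' \<subseteq> ambient k" using twisted_copy_subset_ambient S S' by blast+
    have "?c \<one>\<^bsub>?G\<^esub> (twisted_copy S') \<in> orbit ?G ?c (twisted_copy S')" unfolding orbit_def by blast
    moreover have "?c \<one>\<^bsub>?G\<^esub> (twisted_copy S') = twisted_copy S'"
      using twisted_copy_in_Reg[OF S'] sub by (simp add: conj_on_def G.lcos_mult_one G.coset_mult_one carrier(1))
    ultimately have "twisted_copy S' \<in> orbit ?G ?c (twisted_copy S)" using eq by simp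
    then obtain g where g: "g \<in> ambient k" and "twisted_copy S' = ?c g (twisted_copy S)"
      by (auto simp: orbit_def carrier)
    then have KS': "twisted_copy S' = g <#\<^bsub>?G\<^esub> twisted_copy S #>\<^bsub>?G\<^esub> inv\<^bsub>?G\<^esub> g"
      using twisted_copy_in_Reg[OF S] by (simp add: conj_on_def)
    obtain t T where t: "t \<in> carrier H" "T \<in> poly_sets k" and g_eq: "g = twisted_translation t T" using g by (auto simp: ambient_def)
    show ?thesis
    proof (rule sym_diff_in_poly_sets_of_conj[OF S S' t])
      fix h assume h: "h \<in> carrier H"
      let ?k = "twisted_translation h (diff h S)"
      have k: "?k \<in> twisted_copy S" using h by (auto simp: twisted_copy_def)
      then have "g \<otimes>\<^bsub>?G\<^esub> ?k \<otimes>\<^bsub>?G\<^esub> inv\<^bsub>?G\<^esub> g \<in> twisted_copy S'"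
        unfolding KS' l_coset_def r_coset_def by blast
      then obtain h' where h': "h' \<in> carrier H" "g \<otimes>\<^bsub>?G\<^esub> ?k \<otimes>\<^bsub>?G\<^esub> inv\<^bsub>?G\<^esub> g = twisted_translation h' (diff h' S')"
        by (auto simp: twisted_copy_def)
      have kG: "?k \<in> ambient k" using k sub by blast
      then have "g \<otimes>\<^bsub>?G\<^esub> ?k = twisted_translation h' (diff h' S') \<otimes>\<^bsub>?G\<^esub> g"
        using G.inv_solve_right[of "twisted_translation h' (diff h' S')" "g \<otimes>\<^bsub>?G\<^esub> ?k" g] G.m_closed[of g ?k] g h' sub
        by (auto simp: carrier(1) twisted_copy_def)
      then have "g \<otimes>\<^bsub>?B\<^esub> ?k = twisted_translation h' (diff h' S') \<otimes>\<^bsub>?B\<^esub> g"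
        by (simp add: carrier)
      moreover have "twisted_translation h' (diff h' S') \<in> ambient k" using h' sub by (auto simp: twisted_copy_def)
      ultimately have "compose (carrier H) g ?k = compose (carrier H) (twisted_translation h' (diff h' S')) g"
        using g kG subsetD[OF subgroup.subset[OF subgroup_ambient]] by (auto simp: BijGroup_def)
      then show "\<exists>h'\<in>carrier H. compose (carrier H) (twisted_translation t T) ?k
        = compose (carrier H) (twisted_translation h' (diff h' S')) (twisted_translation t T)" using h' g_eq by blast
    qed
  qed
  ultimately show ?thesis unfolding b_num_def
    by (intro card_le_fibres_sym_diff[OF _ finite_poly_sets])
qed

text \<open>
  The operator \<open>diff z\<close> maps arbitrary subsets to invariant ones, and its kernel consists of the
  invariant ones; so the square of their number is at least the number of all subsets.
\<close>
lemma card_inv_sets: "2 ^ card (carrier H) \<le> card inv_sets ^ 2"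
proof -
  have "diff z S \<in> inv_sets" for S
    by (auto simp: diff_def inv_sets_def)
  moreover have "sym_diff S S' \<in> inv_sets" if "S \<subseteq> carrier H" "S' \<subseteq> carrier H" "diff z S = diff z S'" for S S'
  proof -
    have "z \<otimes> u \<in> S \<longleftrightarrow> u \<in> S \<longleftrightarrow> (z \<otimes> u \<in> S' \<longleftrightarrow> u \<in> S')" if "u \<in> carrier H" for u
      using \<open>diff z S = diff z S'\<close> that unfolding diff_def by blast
    then show ?thesis using that(1,2) unfolding inv_sets_def by blast
  qed
  ultimately have "card (Pow (carrier H)) \<le> card inv_sets * card inv_sets"
    by (intro card_le_fibres_sym_diff[of _ _ "diff z"]) (auto simp: finite_inv_sets)
  then show ?thesis by (simp add: card_Pow finite_carrier power2_eq_square)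
qed

end

section \<open>Nilpotency of the differences and the lower bound\<close>

locale two_generated_involution_group = involution_group +
  fixes x y :: 'a and a :: nat
  assumes x_closed [simp]: "x \<in> carrier H" and y_closed [simp]: "y \<in> carrier H"
    and gen: "generate H {x, y} = carrier H"
    and x_pow: "x [^] (2 ^ a :: nat) = \<one>" and y_pow: "y [^] (2 ^ a :: nat) = \<one>"
begin

text \<open>
  Membership in a shift-invariant group of sets need only be tested on the differences of the two
  generators, by the cocycle identity.
\<close>
lemma diff_closure:
  assumes "{} \<in> Q" and "\<And>S T. S \<in> Q \<Longrightarrow> T \<in> Q \<Longrightarrow> sym_diff S T \<in> Q"
    and "\<And>S h. S \<in> Q \<Longrightarrow> h \<in> carrier H \<Longrightarrow> shift h S \<in> Q"
    and "diff x S \<in> Q" "diff y S \<in> Q" "h \<in> carrier H"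
  shows "diff h S \<in> Q"
proof -
  have "h \<in> generate H {x, y}" using assms gen by simp
  then show ?thesis
  proof induction
    case one
    then show ?case using assms by (simp add: diff_one)
  next
    case (incl h)
    then show ?case using assms by auto
  next
    case (inv h)
    then have h: "h \<in> carrier H" by auto
    have "diff (inv h) S = shift (inv h) (diff h S)"
      using h by (auto simp: diff_def shift_def m_assoc[symmetric])
    then show ?case using inv assms h by auto
  next
    case (eng h1 h2)
    then have "h1 \<in> carrier H" "h2 \<in> carrier H" using gen by auto
    then show ?case using eng assms by (auto simp: diff_mult)
  qed
qed

text \<open>
  An affine function on \<open>H\<close> is determined by its values at \<open>\<one>\<close> and at the two generators.
\<close>
lemma card_poly_sets_0: "card (poly_sets 0) \<le> 8"
proof -
  have "sym_diff S S' \<in> {{}}" if S: "S \<in> poly_sets 0" and S': "S' \<in> poly_sets 0" and eq: "S \<inter> {\<one>, x, y} = S' \<inter> {\<one>, x, y}" for S S'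
  proof -
    define U where "U = sym_diff S S'"
    have U: "U \<in> poly_sets 0" unfolding U_def using poly_sets_sym_diff S S' by blast
    have one: "\<one> \<notin> U" "x \<notin> U" "y \<notin> U" unfolding U_def using eq by blast+
    have "diff h U = {}" if "h \<in> {x,y}" for h
    proof -
      have "diff h U \<in> {{}, carrier H}" using that U by auto
      moreover have "\<one> \<notin> diff h U" using one that unfolding diff_def by auto
      ultimately show ?thesis by auto
    qed
    then have "diff h U = {}" if "h \<in> carrier H" for h
      using diff_closure[of "{{}}" U h] that by (simp add: shift_def)
    then have "\<one> \<notin> diff u U" if "u \<in> carrier H" for u using that by simp
    then have "u \<notin> U" if "u \<in> carrier H" for u using that one(1) by (simp add: diff_def)
    moreover have "U \<subseteq> carrier H" using U poly_sets_inv_sets inv_setsD(1) by blast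
    ultimately have "U = {}" by blast
    then show ?thesis unfolding U_def by simp
  qed
  then have "card (poly_sets 0) \<le> card (Pow {\<one>, x, y}) * card {{} :: 'a set}"
    by (intro card_le_fibres_sym_diff[of _ _ "\<lambda>S. S \<inter> {\<one>, x, y}"]) auto
  also have "\<dots> \<le> 8"
  proof -
    have "card {\<one>, x, y} \<le> 3" by (simp add: card_insert_if)
    then have "(2::nat) ^ card {\<one>, x, y} \<le> 2 ^ 3" by (rule power_increasing) simp
    then show ?thesis by (simp add: card_Pow)
  qed
  finally show ?thesis .
qed

lemma diff_twice: "h \<in> carrier H \<Longrightarrow> diff h (diff h S) = diff (h \<otimes> h) S"
  by (auto simp: diff_def m_assoc)

lemma diff_commute: "g \<in> carrier H \<Longrightarrow> h \<in> carrier H \<Longrightarrow> diff g (diff h S) = diff h (diff g S)"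
  by (auto simp: diff_def m_lcomm[of g h])

text \<open>
  The identity \<open>(X - 1)\<^sup>q = X\<^sup>q - 1\<close> in characteristic \<open>2\<close>, for \<open>q\<close> a power of \<open>2\<close>.
\<close>
lemma diff_pow_two: "h \<in> carrier H \<Longrightarrow> (diff h ^^ (2 ^ i)) S = diff (h [^] (2 ^ i :: nat)) S"
proof (induction i arbitrary: S)
  case (Suc i)
  have "(diff h ^^ (2 ^ Suc i)) S = (diff h ^^ (2 ^ i)) ((diff h ^^ (2 ^ i)) S)"
    by (simp add: mult_2 funpow_add)
  then show ?case using Suc by (simp add: diff_twice nat_pow_mult mult_2)
qed simp

lemma diff_funpow_empty: "(diff h ^^ i) {} = {}"
  by (induction i) (auto simp: diff_def)

lemma diff_funpow_vanishes:
  assumes "h \<in> carrier H" "h [^] (2 ^ a :: nat) = \<one>" "2 ^ a \<le> i"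
  shows "(diff h ^^ i) S = {}"
proof -
  have "(diff h ^^ i) S = (diff h ^^ (i - 2 ^ a)) ((diff h ^^ (2 ^ a)) S)"
    using assms(3) by (metis comp_apply funpow_add le_add_diff_inverse2)
  then show ?thesis using assms by (simp add: diff_pow_two diff_one diff_funpow_empty)
qed

lemma diff_funpow_commute: "g \<in> carrier H \<Longrightarrow> h \<in> carrier H \<Longrightarrow> diff g ((diff h ^^ i) S) = (diff h ^^ i) (diff g S)"
proof (induction i)
  case (Suc i)
  then show ?case using diff_commute[of g h "(diff h ^^ i) S"] by simp
qed simp

lemma inv_sets_funpow: "h \<in> carrier H \<Longrightarrow> S \<in> inv_sets \<Longrightarrow> (diff h ^^ i) S \<in> inv_sets"
  by (induction i) (simp_all add: inv_sets_diff)

text \<open>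
  When \<open>i + j\<close> reaches \<open>2 * 2 ^ a\<close>, one of \<open>i\<close> and \<open>j\<close> is at least \<open>2 ^ a\<close> and the iterated
  difference vanishes.  Counting down from there, each missing difference costs one level.
\<close>
lemma diff_funpow_in_poly_sets:
  assumes "S \<in> inv_sets" "2 * 2 ^ a \<le> i + j + k"
  shows "(diff x ^^ i) ((diff y ^^ j) S) \<in> poly_sets k"
  using assms(2)
proof (induction k arbitrary: i j)
  case 0
  then have "2 ^ a \<le> i \<or> 2 ^ a \<le> j" by linarith
  then have "(diff x ^^ i) ((diff y ^^ j) S) = {}"
    using diff_funpow_vanishes x_pow y_pow diff_funpow_empty by auto
  then show ?case by (simp only: empty_in_poly_sets)
next
  case (Suc k)
  let ?S = "(diff x ^^ i) ((diff y ^^ j) S)"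
  have "diff x ?S \<in> poly_sets k" using Suc.IH[of "Suc i" j] Suc.prems by simp
  moreover have "diff y ?S \<in> poly_sets k"
    using Suc.IH[of i "Suc j"] Suc.prems by (simp add: diff_funpow_commute)
  ultimately have "diff h ?S \<in> poly_sets k" if "h \<in> carrier H" for h
    using diff_closure[of "poly_sets k"] that empty_in_poly_sets poly_sets_sym_diff poly_sets_shift by blast
  then show ?case using assms(1) by (simp add: inv_sets_funpow)
qed

text \<open>
  The bound \<open>N\<close> on the number of classes is imposed for all \<open>k\<close>: which of the groups
  \<open>ambient k\<close> has many classes is left open by this pigeonhole argument.
\<close>
lemma b_num_lower_bound:
  fixes N :: real
  assumes N: "\<And>k. real (b_num H (carrier H) (ambient k)) \<le> N"
  shows "2 ^ card (carrier H) \<le> (8 * N ^ (2 * 2 ^ a)) ^ 2"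
proof -
  have N0: "0 \<le> N" using N[of 0] by linarith
  have bound: "real (card (poly_sets k)) \<le> 8 * N ^ k" for k
  proof (induction k)
    case 0
    then show ?case using card_poly_sets_0 by (simp del: poly_sets.simps)
  next
    case (Suc k)
    have "real (card (poly_sets (Suc k))) \<le> real (b_num H (carrier H) (ambient k)) * real (card (poly_sets k))"
      using b_num_bound[of k] by (metis of_nat_le_iff of_nat_mult)
    also have "\<dots> \<le> N * (8 * N ^ k)" by (intro mult_mono N Suc) (use N0 in auto)
    finally show ?case by simp
  qed
  have "inv_sets \<subseteq> poly_sets (2 * 2 ^ a)"
    using diff_funpow_in_poly_sets[of _ 0 0 "2 * 2 ^ a"] by auto
  then have "card inv_sets \<le> card (poly_sets (2 * 2 ^ a))" by (intro card_mono finite_poly_sets)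
  then have "real (card inv_sets) \<le> 8 * N ^ (2 * 2 ^ a)" using bound order_trans of_nat_mono by blast
  then have "real (card inv_sets) ^ 2 \<le> (8 * N ^ (2 * 2 ^ a)) ^ 2" by (intro power_mono) auto
  moreover have "real (2 ^ card (carrier H)) \<le> real (card inv_sets ^ 2)"
    using card_inv_sets of_nat_mono by blast
  ultimately show ?thesis by simp
qed

end

section \<open>The square of a cyclic group, on natural numbers\<close>

definition nat_torus :: "nat \<Rightarrow> nat monoid"
  where "nat_torus m = \<lparr>carrier = prod_encode ` ({..<m} \<times> {..<m}),
     mult = (\<lambda>p q. case (prod_decode p, prod_decode q) of
        ((i, j), (k, l)) \<Rightarrow> prod_encode ((i + k) mod m, (j + l) mod m)),
     one = prod_encode (0, 0)\<rparr>"

context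
  fixes m :: nat
  assumes m: "1 < m"
begin

lemma nat_torus_simps [simp]:
  "prod_encode (i, j) \<in> carrier (nat_torus m) \<longleftrightarrow> i < m \<and> j < m"
  "prod_encode (i, j) \<otimes>\<^bsub>nat_torus m\<^esub> prod_encode (k, l) = prod_encode ((i + k) mod m, (j + l) mod m)"
  "\<one>\<^bsub>nat_torus m\<^esub> = prod_encode (0, 0)"
  by (auto simp: nat_torus_def)

lemma nat_torus_cases:
  assumes "p \<in> carrier (nat_torus m)"
  obtains i j where "i < m" "j < m" "p = prod_encode (i, j)"
  using assms by (auto simp: nat_torus_def)

lemma comm_group_nat_torus: "comm_group (nat_torus m)"
proof (rule comm_groupI)
  fix p assume "p \<in> carrier (nat_torus m)"
  then obtain i j where p: "i < m" "j < m" "p = prod_encode (i, j)" by (rule nat_torus_cases)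
  then have "prod_encode ((m - i) mod m, (m - j) mod m) \<otimes>\<^bsub>nat_torus m\<^esub> p = \<one>\<^bsub>nat_torus m\<^esub>"
    by (simp add: mod_add_left_eq)
  moreover have "prod_encode ((m - i) mod m, (m - j) mod m) \<in> carrier (nat_torus m)"
    using m by simp
  ultimately show "\<exists>q\<in>carrier (nat_torus m). q \<otimes>\<^bsub>nat_torus m\<^esub> p = \<one>\<^bsub>nat_torus m\<^esub>" by blast
qed (use m in \<open>auto elim!: nat_torus_cases simp: mod_add_left_eq mod_add_right_eq ac_simps\<close>)

lemma card_nat_torus: "card (carrier (nat_torus m)) = m * m"
  by (simp add: nat_torus_def card_image inj_prod_encode)

lemma nat_torus_pow:
  "prod_encode (1, 0) [^]\<^bsub>nat_torus m\<^esub> i = prod_encode (i mod m, 0)"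
  "prod_encode (0, 1) [^]\<^bsub>nat_torus m\<^esub> i = prod_encode (0, i mod m)"
  for i :: nat
  by (induction i) (simp_all add: nat_pow_def mod_simps)

lemma generate_nat_torus:
  "generate (nat_torus m) {prod_encode (1, 0), prod_encode (0, 1)} = carrier (nat_torus m)"
  (is "generate _ {?x, ?y} = _")
proof
  interpret comm_group "nat_torus m" by (rule comm_group_nat_torus)
  have sub: "{?x, ?y} \<subseteq> carrier (nat_torus m)" using m by simp
  then show "generate (nat_torus m) {?x, ?y} \<subseteq> carrier (nat_torus m)" by (rule generate_incl)
  have sg: "subgroup (generate (nat_torus m) {?x, ?y}) (nat_torus m)"
    by (rule generate_is_subgroup[OF sub])
  have pow: "g [^]\<^bsub>nat_torus m\<^esub> i \<in> generate (nat_torus m) {?x, ?y}" if "g \<in> {?x, ?y}" for g and i :: nat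
  proof (induction i)
    case 0
    then show ?case by (simp add: generate.one del: nat_torus_simps)
  next
    case (Suc i)
    show ?case unfolding nat_pow_Suc by (rule generate.eng[OF Suc generate.incl[OF that]])
  qed
  show "carrier (nat_torus m) \<subseteq> generate (nat_torus m) {?x, ?y}"
  proof
    fix p assume "p \<in> carrier (nat_torus m)"
    then obtain i j where p: "i < m" "j < m" "p = prod_encode (i, j)" by (rule nat_torus_cases)
    have "p = ?x [^]\<^bsub>nat_torus m\<^esub> i \<otimes>\<^bsub>nat_torus m\<^esub> ?y [^]\<^bsub>nat_torus m\<^esub> j"
      using p by (simp only: nat_torus_pow nat_torus_simps) simp
    also have "\<dots> \<in> generate (nat_torus m) {?x, ?y}"
      by (intro generate.eng pow) simp_all
    finally show "p \<in> generate (nat_torus m) {?x, ?y}" .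
  qed
qed

end

lemma involution_group_nat_torus:
  assumes a: "1 \<le> a"
  shows "two_generated_involution_group (nat_torus (2 ^ a)) (prod_encode (2 ^ (a - 1), 0))
    (prod_encode (1, 0)) (prod_encode (0, 1)) a"
proof -
  have m: "1 < (2 ^ a :: nat)" by (rule one_less_power) (use a in auto)
  have half: "(2::nat) ^ (a - 1) + 2 ^ (a - 1) = 2 ^ a" using a by (cases a) auto
  have pos: "0 < (2::nat) ^ (a - 1)" by simp
  have half_less: "(2::nat) ^ (a - 1) < 2 ^ a" using half pos by linarith
  have "finite (carrier (nat_torus (2 ^ a)))" by (simp add: nat_torus_def)
  then show ?thesis
    using comm_group_nat_torus[OF m] generate_nat_torus[OF m] nat_torus_pow[OF m, of "2 ^ a"]
      half half_less pos m
    by (intro two_generated_involution_group.intro involution_group.intro involution_group_axioms.intro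
          two_generated_involution_group_axioms.intro)
      (simp_all add: prod_encode_eq)
qed

section \<open>Failure of every polynomial bound\<close>

text \<open>
  With \<open>m = 2 ^ a\<close> and \<open>N = (m\<^sup>2) powr c\<close>, the two sides are the binary logarithms of the right and
  of the left side of \<open>b_num_lower_bound\<close>.
\<close>
lemma exponent_gap:
  fixes c :: real
  shows "\<exists>a\<ge>1. 6 + 8 * c * real a * 2 ^ a < 4 ^ a"
proof -
  have "(\<lambda>a. 6 * (1 / 2) ^ a + 8 * c * (real a / 2 ^ a)) \<longlonglongrightarrow> 6 * 0 + 8 * c * (0 :: real)"
    by (intro tendsto_intros LIMSEQ_power_zero lim_n_over_pown) simp_all
  then have "\<forall>\<^sub>F a in sequentially. 6 * (1 / 2) ^ a + 8 * c * (real a / 2 ^ a) < 1"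
    by (rule order_tendstoD) simp
  then have "\<forall>\<^sub>F a in sequentially. 1 \<le> a \<and> 6 * (1 / 2) ^ a + 8 * c * (real a / 2 ^ a) < 1"
    by (intro eventually_conj eventually_ge_at_top)
  then obtain a where a: "1 \<le> a" "6 * (1 / 2) ^ a + 8 * c * (real a / 2 ^ a) < 1"
    unfolding eventually_sequentially by blast
  have "(6 * (1 / 2) ^ a + 8 * c * (real a / 2 ^ a)) * 2 ^ a < 1 * 2 ^ a"
    using a(2) by (intro mult_strict_right_mono) auto
  also have "(6 * (1 / 2) ^ a + 8 * c * (real a / 2 ^ a)) * 2 ^ a = 6 + 8 * c * real a"
    by (simp add: field_simps power_one_over)
  finally have "6 + 8 * c * real a < 2 ^ a" by simp
  then have "(6 + 8 * c * real a) * 2 ^ a < 2 ^ a * 2 ^ a" by simp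
  moreover have "(6::real) \<le> 6 * 2 ^ a" by simp
  ultimately have "6 + 8 * c * real a * 2 ^ a < 2 ^ a * 2 ^ a" unfolding distrib_right by linarith
  also have "(2::real) ^ a * 2 ^ a = 4 ^ a" by (simp add: power_mult_distrib[symmetric])
  finally show ?thesis using a(1) by blast
qed

theorem mainTheorem2:
  shows "\<not> (\<exists>f :: nat \<Rightarrow> real. \<forall>r \<ge> 1. \<forall>(H :: nat monoid) (n :: nat) (\<Omega> :: nat set) \<Gamma>.
      comm_group H \<and> finite (carrier H) \<and> group_rank H \<le> r \<and> n = order H \<and>
      finite \<Omega> \<and> card \<Omega> = n \<and> subgroup \<Gamma> (BijGroup \<Omega>) \<longrightarrow>
      real (b_num H \<Omega> \<Gamma>) \<le> real n powr f r)"
proof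
  assume "\<exists>f :: nat \<Rightarrow> real. \<forall>r \<ge> 1. \<forall>(H :: nat monoid) (n :: nat) (\<Omega> :: nat set) \<Gamma>.
      comm_group H \<and> finite (carrier H) \<and> group_rank H \<le> r \<and> n = order H \<and>
      finite \<Omega> \<and> card \<Omega> = n \<and> subgroup \<Gamma> (BijGroup \<Omega>) \<longrightarrow>
      real (b_num H \<Omega> \<Gamma>) \<le> real n powr f r"
  then obtain f :: "nat \<Rightarrow> real" where f: "\<And>r (H :: nat monoid) (\<Omega> :: nat set) \<Gamma>.
      1 \<le> r \<Longrightarrow> comm_group H \<Longrightarrow> finite (carrier H) \<Longrightarrow> group_rank H \<le> r \<Longrightarrow>
      finite \<Omega> \<Longrightarrow> card \<Omega> = order H \<Longrightarrow> subgroup \<Gamma> (BijGroup \<Omega>) \<Longrightarrow>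
      real (b_num H \<Omega> \<Gamma>) \<le> real (order H) powr f r"
    by blast
  define c where "c = f 2"
  obtain a where a: "1 \<le> a" "6 + 8 * c * real a * 2 ^ a < 4 ^ a"
    using exponent_gap by blast
  define x y where "x = prod_encode (1, 0)" and "y = prod_encode (0, 1)"
  let ?H = "nat_torus (2 ^ a)"
  interpret two_generated_involution_group ?H "prod_encode (2 ^ (a - 1), 0)" x y a
    unfolding x_def y_def using a(1) by (rule involution_group_nat_torus)
  have m: "1 < (2 ^ a :: nat)" by (rule one_less_power) (use a in auto)
  have order: "order ?H = 2 ^ a * 2 ^ a" by (simp add: order_def card_nat_torus[OF m])
  have "group_rank ?H \<le> card {x, y}"
    unfolding group_rank_def using gen by (intro Least_le exI[of _ "{x, y}"]) auto
  also have "\<dots> \<le> 2" by (simp add: card_insert_if)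
  finally have rank: "group_rank ?H \<le> 2" .
  define N where "N = 2 powr (2 * real a * c)"
  have "real (order ?H) = 2 powr (2 * real a)"
    by (simp add: order powr_realpow[symmetric] powr_add[symmetric])
  then have "real (order ?H) powr c = N" by (simp add: N_def powr_powr)
  then have "real (b_num ?H (carrier ?H) (ambient k)) \<le> N" for k
    using f[of 2 ?H "carrier ?H" "ambient k"] rank finite_carrier subgroup_ambient comm_group_axioms
    by (simp add: c_def order_def)
  then have "2 ^ card (carrier ?H) \<le> (8 * N ^ (2 * 2 ^ a)) ^ 2"
    by (rule b_num_lower_bound)
  moreover have "(2::real) ^ card (carrier ?H) = 2 powr (4 ^ a)"
  proof -
    have "real (card (carrier ?H)) = 4 ^ a" by (simp add: card_nat_torus[OF m] power_mult_distrib[symmetric])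
    then show ?thesis by (metis powr_realpow zero_less_numeral)
  qed
  moreover have "(8 * N ^ (2 * 2 ^ a)) ^ 2 = 2 powr (6 + 8 * c * real a * 2 ^ a)"
  proof -
    have "N ^ (2 * 2 ^ a) = N powr (2 * 2 ^ a)" by (simp add: N_def powr_realpow[symmetric])
    also have "\<dots> = 2 powr (4 * c * real a * 2 ^ a)" by (simp add: N_def powr_powr mult_ac)
    finally have "8 * N ^ (2 * 2 ^ a) = 2 powr (3 + 4 * c * real a * 2 ^ a)"
      by (simp add: powr_add)
    then show ?thesis by (simp add: power2_eq_square powr_add[symmetric] algebra_simps)
  qed
  ultimately have "(4::real) ^ a \<le> 6 + 8 * c * real a * 2 ^ a" by simp
  then show False using a(2) by simp
qed

end
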